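(* Let $f:\mathbb{H}\to\mathbb{H}$ be a slice regular function such that for every $\varepsilon>0$ one has $|f(q)|<e^{\varepsilon|q|}$ for all $q$ with $|q|$ sufficiently large (i.e. $f$ has order at most $1$ and type $0$). If for some $I\in\mathbb{S}$ the plane $L_I$ contains a (real) line on which $|f|$ is bounded, then $f$ is constant.
   Context: $\mathbb{H}$ denotes the quaternions with Euclidean norm $|q|$; $\mathbb{S}=\{ix_1+jx_2+kx_3: x_1^2+x_2^2+x_3^2=1\}$; for $I\in\mathbb{S}$, $L_I=\mathbb{R}+\mathbb{R}I$. A function $f:\mathbb{H}\to\mathbb{H}$ is slice regular if for every $I\in\mathbb{S}$ its restriction $f_I$ to $L_I$ satisfies $\frac12\left(\frac{\partial}{\partial x}+I\frac{\partial}{\partial y}\right)f_I(x+yI)=0$. *)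

theory Defs
  imports "HOL-Analysis.Analysis"
begin

text \<open>Quaternions modelled as R^4 = real * real * real * real, coordinates (a,b,c,d)
  standing for a + b i + c j + d k.  The product norm on this type is the Euclidean norm.\<close>

type_synonym quat = "real \<times> real \<times> real \<times> real"

fun qmult :: "quat \<Rightarrow> quat \<Rightarrow> quat" where
  "qmult (a1, b1, c1, d1) (a2, b2, c2, d2) =
     (a1*a2 - b1*b2 - c1*c2 - d1*d2,
      a1*b2 + b1*a2 + c1*d2 - d1*c2,
      a1*c2 - b1*d2 + c1*a2 + d1*b2,
      a1*d2 + b1*c2 - c1*b2 + d1*a2)"

definition qreal :: "real \<Rightarrow> quat" where
  "qreal x = (x, 0, 0, 0)"

definition imag_units :: "quat set" where
  "imag_units = {(0, x1, x2, x3) | x1 x2 x3. x1^2 + x2^2 + x3^2 = 1}"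

definition slice_pt :: "quat \<Rightarrow> real \<Rightarrow> real \<Rightarrow> quat" where
  "slice_pt I x y = qreal x + y *\<^sub>R I"

definition slice_regular :: "(quat \<Rightarrow> quat) \<Rightarrow> bool" where
  "slice_regular f \<longleftrightarrow>
     (\<forall>I\<in>imag_units. \<forall>x y. \<exists>D.
        ((\<lambda>p. f (slice_pt I (fst p) (snd p))) has_derivative D) (at (x, y)) \<and>
        (1/2) *\<^sub>R (D (1, 0) + qmult I (D (0, 1))) = 0)"

end

theory Submission
  imports Defs "HOL-Complex_Analysis.Complex_Analysis" "HOL-Real_Asymp.Real_Asymp"
begin

text \<open>
  Left multiplication by \<open>I\<close> is a complex structure on the quaternions, and slice regularity
  says that \<open>f\<close> is holomorphic on \<open>L\<^sub>I\<close> with respect to it. Pairing with complex-linear functionals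
  reduces the problem on \<open>L\<^sub>I\<close> to an entire \<open>F\<close> with \<open>|F z| \<le> C\<^sub>\<epsilon> exp (\<epsilon> |z|)\<close> for every \<open>\<epsilon> > 0\<close>,
  bounded by \<open>M\<close> on the real axis after an affine change of variable. Then \<open>F z exp (\<i> \<epsilon> z)\<close> is
  also bounded on the positive imaginary axis. By Phragmen--Lindeloef it is bounded in both
  quadrants, whose critical order is 2, hence by \<open>M\<close> in the upper half-plane, whose critical order is 1.
  Letting \<open>\<epsilon>\<close> tend to 0 gives \<open>|F| \<le> M\<close>, so \<open>F\<close> is constant by Liouville.
  Thus \<open>f\<close> is constant on \<open>L\<^sub>I\<close>, in particular on the real axis. That is a line in every slice, so the
  same argument makes \<open>f\<close> constant on each of them.
\<close>

section \<open>The Phragmen--Lindeloef principle\<close>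

lemma le_mult_exp_imp_le:
  fixes a b x :: real
  assumes "\<And>\<epsilon>. 0 < \<epsilon> \<Longrightarrow> a \<le> b * exp (\<epsilon> * x)"
  shows "a \<le> b"
proof -
  have "((\<lambda>\<epsilon>. b * exp (\<epsilon> * x)) \<longlongrightarrow> b * exp (0 * x)) (at_right 0)"
    by (intro tendsto_intros)
  moreover have "\<forall>\<^sub>F \<epsilon> in at_right 0. a \<le> b * exp (\<epsilon> * x)"
    using assms by (auto intro: eventually_at_rightI[of 0 1])
  ultimately show ?thesis
    by (auto dest: tendsto_lowerbound)
qed

lemma phragmen_lindelof_damping:
  fixes g D :: "complex \<Rightarrow> complex"
  assumes S: "closed S"
    and g: "g holomorphic_on interior S" "continuous_on S g"
    and D: "D holomorphic_on interior S" "continuous_on S D"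
    and D_nonneg: "\<And>w. w \<in> frontier S \<Longrightarrow> 0 \<le> Re (D w)"
    and frontier: "\<And>w. w \<in> frontier S \<Longrightarrow> norm (g w) \<le> K"
    and damped: "\<And>\<delta>. 0 < \<delta> \<Longrightarrow>
      \<forall>\<^sub>F w in at_infinity. w \<in> S \<longrightarrow> norm (g w) * exp (- (\<delta> * Re (D w))) \<le> K"
    and z: "z \<in> S"
  shows "norm (g z) \<le> K"
proof (rule le_mult_exp_imp_le)
  fix \<delta> :: real assume "0 < \<delta>"
  define h where "h w = g w * exp (- of_real \<delta> * D w)" for w
  have norm_h: "norm (h w) = norm (g w) * exp (- (\<delta> * Re (D w)))" for w
    by (simp add: h_def norm_mult)
  obtain b where b: "norm (h w) \<le> K" if "b \<le> norm w" "w \<in> S" for w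
    using damped[OF \<open>0 < \<delta>\<close>] unfolding norm_h eventually_at_infinity by blast
  define T where "T = S \<inter> cball 0 (max b (norm z))"
  have "closed T" "bounded T" "T \<subseteq> S"
    using S by (auto simp: T_def)
  have "norm (h z) \<le> K"
  proof (rule maximum_modulus_frontier[where f = h and S = T])
    show "h holomorphic_on interior T"
      unfolding h_def using interior_mono[OF \<open>T \<subseteq> S\<close>] g(1) D(1)
      by (intro holomorphic_intros) (auto intro: holomorphic_on_subset)
    show "continuous_on (closure T) h"
      unfolding h_def closure_closed[OF \<open>closed T\<close>] using \<open>T \<subseteq> S\<close> g(2) D(2)
      by (intro continuous_intros) (auto intro: continuous_on_subset)
    show "norm (h w) \<le> K" if "w \<in> frontier T" for w
    proof -
      have "w \<in> S" "w \<in> frontier S \<or> norm w = max b (norm z)"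
        using that S frontier_subset_closed[OF S] by (auto simp: T_def frontier_Int_closed)
      moreover have "norm (h w) \<le> norm (g w)" if "w \<in> frontier S"
        unfolding norm_h using D_nonneg[OF that] \<open>0 < \<delta>\<close> by (intro mult_left_le) auto
      ultimately show ?thesis
        using b frontier order_trans by fastforce
    qed
  qed (use z \<open>bounded T\<close> in \<open>auto simp: T_def\<close>)
  then show "norm (g z) \<le> K * exp (\<delta> * Re (D z))"
    by (simp add: norm_h exp_minus field_simps)
qed

lemma powr_diff_at_bot:
  fixes c d \<rho> \<beta> :: real
  assumes "\<rho> < \<beta>" "0 < \<beta>" "0 < d"
  shows "filterlim (\<lambda>r. c * r powr \<rho> - d * r powr \<beta>) at_bot at_top"
proof -
  have "((\<lambda>r. c * r powr (\<rho> - \<beta>) - d) \<longlongrightarrow> c * 0 - d) at_top"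
    using assms by (intro tendsto_intros tendsto_neg_powr filterlim_ident) auto
  then have "filterlim (\<lambda>r. (c * r powr (\<rho> - \<beta>) - d) * r powr \<beta>) at_bot at_top"
    using assms by (intro filterlim_tendsto_neg_mult_at_bot real_powr_at_top) auto
  moreover have "\<forall>\<^sub>F r in at_top. (c * r powr (\<rho> - \<beta>) - d) * r powr \<beta> = c * r powr \<rho> - d * r powr \<beta>"
    using eventually_gt_at_top[of 0] by eventually_elim (simp add: algebra_simps flip: powr_add)
  ultimately show ?thesis
    by (simp add: filterlim_cong)
qed

lemma eventually_damped_le:
  fixes g :: "'a::real_normed_vector \<Rightarrow> 'b::real_normed_vector" and u :: "'a \<Rightarrow> real"
  assumes \<beta>: "\<rho> < \<beta>" "0 < \<beta>" and "0 < d" "0 < K"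
    and growth: "\<And>w. w \<in> S \<Longrightarrow> norm (g w) \<le> C * exp (c * norm w powr \<rho>)"
    and damping: "\<And>w. w \<in> S \<Longrightarrow> d * norm w powr \<beta> \<le> u w"
  shows "\<forall>\<^sub>F w in at_infinity. w \<in> S \<longrightarrow> norm (g w) * exp (- u w) \<le> K"
proof -
  have "((\<lambda>r. C * exp (c * r powr \<rho> - d * r powr \<beta>)) \<longlongrightarrow> 0) at_top"
    using \<beta> \<open>0 < d\<close>
    by (intro tendsto_mult_right_zero filterlim_compose[OF exp_at_bot] powr_diff_at_bot)
  then have "\<forall>\<^sub>F r in at_top. C * exp (c * r powr \<rho> - d * r powr \<beta>) < K"
    using \<open>0 < K\<close> by (rule order_tendstoD)
  then have "\<forall>\<^sub>F w :: 'a in at_infinity. C * exp (c * norm w powr \<rho> - d * norm w powr \<beta>) < K"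
    by (rule eventually_compose_filterlim[OF _ filterlim_norm_at_top])
  then show ?thesis
  proof (eventually_elim, intro impI)
    fix w assume decay: "C * exp (c * norm w powr \<rho> - d * norm w powr \<beta>) < K" and w: "w \<in> S"
    have "norm (g w) * exp (- u w) \<le> C * exp (c * norm w powr \<rho>) * exp (- (d * norm w powr \<beta>))"
      using damping[OF w] order_trans[OF norm_ge_zero growth[OF w]]
      by (intro mult_mono growth[OF w]) auto
    also have "\<dots> = C * exp (c * norm w powr \<rho> - d * norm w powr \<beta>)"
      by (simp add: exp_diff exp_minus field_simps)
    finally show "norm (g w) * exp (- u w) \<le> K"
      using decay by simp
  qed
qed

lemma phragmen_lindelof_order:
  fixes g D :: "complex \<Rightarrow> complex"
  assumes S: "closed S"
    and g: "g holomorphic_on interior S" "continuous_on S g"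
    and growth: "\<And>w. w \<in> S \<Longrightarrow> norm (g w) \<le> C * exp (c * norm w powr \<rho>)"
    and D: "D holomorphic_on interior S" "continuous_on S D"
    and D_ge: "\<And>w. w \<in> S \<Longrightarrow> \<kappa> * norm w powr \<beta> \<le> Re (D w)"
    and order: "\<rho> < \<beta>" "0 < \<beta>" "0 < \<kappa>"
    and frontier: "\<And>w. w \<in> frontier S \<Longrightarrow> norm (g w) \<le> K" and K: "0 \<le> K"
    and z: "z \<in> S"
  shows "norm (g z) \<le> K"
proof (rule dense_ge)
  fix K' assume "K < K'"
  show "norm (g z) \<le> K'"
  proof (rule phragmen_lindelof_damping[OF S g D _ _ _ z])
    fix w assume w: "w \<in> frontier S"
    then have "\<kappa> * norm w powr \<beta> \<le> Re (D w)"
      using D_ge frontier_subset_closed[OF S] by blast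
    then show "0 \<le> Re (D w)"
      using order(3) by (elim order_trans[rotated]) simp
    show "norm (g w) \<le> K'"
      using frontier[OF w] \<open>K < K'\<close> by simp
  next
    fix \<delta> :: real assume "0 < \<delta>"
    then show "\<forall>\<^sub>F w in at_infinity. w \<in> S \<longrightarrow> norm (g w) * exp (- (\<delta> * Re (D w))) \<le> K'"
      using order(3) K \<open>K < K'\<close> D_ge
      by (intro eventually_damped_le[where d = "\<delta> * \<kappa>", OF order(1,2) _ _ growth]) (auto simp: mult.assoc)
  qed
qed

definition sector :: "real \<Rightarrow> real \<Rightarrow> complex set" where
  "sector a b = {rcis r t | r t. 0 \<le> r \<and> a \<le> t \<and> t \<le> b}"

lemma rcis_in_sector: "0 \<le> r \<Longrightarrow> a \<le> t \<Longrightarrow> t \<le> b \<Longrightarrow> rcis r t \<in> sector a b"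
  by (auto simp: sector_def)

lemma sector_mono: "a' \<le> a \<Longrightarrow> b \<le> b' \<Longrightarrow> sector a b \<subseteq> sector a' b'"
  by (force simp: sector_def)

lemma sector_split:
  assumes "a \<le> m" "m \<le> b"
  shows "sector a b = sector a m \<union> sector m b"
proof (intro equalityI subsetI)
  fix z assume "z \<in> sector a b"
  then obtain r t where "z = rcis r t" "0 \<le> r" "a \<le> t" "t \<le> b"
    by (auto simp: sector_def)
  then show "z \<in> sector a m \<union> sector m b"
    by (cases "t \<le> m") (auto intro!: rcis_in_sector)
qed (use sector_mono[of a a m b] sector_mono[of a m b b] assms in auto)

lemma rotate_sector: "(\<lambda>z. cis \<phi> * z) ` sector a b = sector (a + \<phi>) (b + \<phi>)"
proof -
  have cis_rcis: "cis \<phi> * rcis r t = rcis r (t + \<phi>)" for r t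
    by (simp add: cis_rcis_eq rcis_mult add.commute)
  show ?thesis
  proof (intro equalityI subsetI)
    fix w assume "w \<in> sector (a + \<phi>) (b + \<phi>)"
    then obtain r t where "w = rcis r t" "0 \<le> r" "a + \<phi> \<le> t" "t \<le> b + \<phi>"
      by (auto simp: sector_def)
    then show "w \<in> (\<lambda>z. cis \<phi> * z) ` sector a b"
      using cis_rcis[of r "t - \<phi>"] by (intro image_eqI[of _ _ "rcis r (t - \<phi>)"] rcis_in_sector) auto
  qed (auto simp: cis_rcis sector_def[of a b] intro!: rcis_in_sector)
qed

lemma symmetric_sector_eq:
  assumes "0 \<le> \<theta>" "\<theta> \<le> pi"
  shows "sector (- \<theta>) \<theta> = {z. norm z * cos \<theta> \<le> Re z}"
proof (intro equalityI subsetI)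
  fix z assume "z \<in> sector (- \<theta>) \<theta>"
  then obtain r t where z: "z = rcis r t" "0 \<le> r" "\<bar>t\<bar> \<le> \<theta>"
    by (auto simp: sector_def)
  have "cos \<theta> \<le> cos \<bar>t\<bar>"
    using z assms by (intro cos_monotone_0_pi_le) auto
  with z show "z \<in> {z. norm z * cos \<theta> \<le> Re z}"
    by (simp add: mult_left_mono)
next
  fix z assume z: "z \<in> {z. norm z * cos \<theta> \<le> Re z}"
  have "\<bar>Arg z\<bar> \<le> \<theta>"
  proof (cases "z = 0")
    case False
    have "norm z * cos \<theta> \<le> norm z * cos (Arg z)"
      using z by (metis Re_rcis mem_Collect_eq rcis_cmod_Arg)
    with False have "cos \<theta> \<le> cos \<bar>Arg z\<bar>"
      by simp
    then show ?thesis
      using assms Arg_bounded[of z] by (subst (asm) cos_mono_le_eq) auto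
  qed (use assms in \<open>simp add: Arg_zero\<close>)
  then have "rcis (norm z) (Arg z) \<in> sector (- \<theta>) \<theta>"
    using assms by (intro rcis_in_sector) auto
  then show "z \<in> sector (- \<theta>) \<theta>"
    by (simp add: rcis_cmod_Arg)
qed

lemma closed_symmetric_sector:
  assumes "0 \<le> \<theta>" "\<theta> \<le> pi"
  shows "closed (sector (- \<theta>) \<theta>)"
  unfolding symmetric_sector_eq[OF assms]
  by (intro closed_Collect_le continuous_intros)

lemma frontier_symmetric_sector:
  assumes "0 \<le> \<theta>" "\<theta> \<le> pi" "z \<in> frontier (sector (- \<theta>) \<theta>)"
  obtains r where "0 \<le> r" "z = rcis r (- \<theta>) \<or> z = rcis r \<theta>"
proof -
  let ?U = "{z. norm z * cos \<theta> < Re z}"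
  have "open ?U"
    by (intro open_Collect_less continuous_intros)
  then have "?U \<subseteq> interior (sector (- \<theta>) \<theta>)"
    unfolding symmetric_sector_eq[OF assms(1,2)] by (intro interior_maximal) auto
  moreover have "z \<in> sector (- \<theta>) \<theta>" "z \<notin> interior (sector (- \<theta>) \<theta>)"
    using assms(3) closed_symmetric_sector[OF assms(1,2)] by (auto simp: frontier_def)
  ultimately have "Re z = norm z * cos \<theta>"
    unfolding symmetric_sector_eq[OF assms(1,2)] by force
  moreover have "Re z = norm z * cos (Arg z)"
    by (metis Re_rcis rcis_cmod_Arg)
  ultimately have "z = 0 \<or> cos \<theta> = cos \<bar>Arg z\<bar>"
    by auto
  then have "z = 0 \<or> \<bar>Arg z\<bar> = \<theta>"
    using assms(1,2) Arg_bounded[of z] by (auto intro: cos_inj_pi)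
  then have "z = rcis (norm z) (- \<theta>) \<or> z = rcis (norm z) \<theta>"
    using rcis_cmod_Arg[of z] by (auto simp: abs_if split: if_splits)
  then show ?thesis
    using that[of "norm z"] by simp
qed

lemma symmetric_sector_Int_nonpos_Reals:
  assumes "\<theta> < pi"
  shows "sector (- \<theta>) \<theta> \<inter> \<real>\<^sub>\<le>\<^sub>0 \<subseteq> {0}"
proof
  fix z assume z: "z \<in> sector (- \<theta>) \<theta> \<inter> \<real>\<^sub>\<le>\<^sub>0"
  show "z \<in> {0}"
  proof (rule ccontr)
    assume "z \<notin> {0}"
    with z assms obtain r t where "z = rcis r t" "0 < r" "\<bar>t\<bar> < pi"
      by (force simp: sector_def)
    then have "Arg z = t"
      by (simp add: Arg_rcis abs_less_iff)
    moreover have "Arg z = pi"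
      using z \<open>z \<notin> {0}\<close> by (auto simp: Arg_eq_pi complex_nonpos_Reals_iff complex_eq_iff)
    ultimately show False
      using \<open>\<bar>t\<bar> < pi\<close> by simp
  qed
qed

lemma interior_symmetric_sector_Int_nonpos_Reals:
  assumes "\<theta> < pi"
  shows "interior (sector (- \<theta>) \<theta>) \<inter> \<real>\<^sub>\<le>\<^sub>0 = {}"
proof -
  have "0 \<notin> interior (sector (- \<theta>) \<theta>)"
  proof
    assume "0 \<in> interior (sector (- \<theta>) \<theta>)"
    then obtain e where e: "0 < e" "cball 0 e \<subseteq> sector (- \<theta>) \<theta>"
      by (auto simp: mem_interior_cball)
    then have "- of_real e \<in> sector (- \<theta>) \<theta> \<inter> \<real>\<^sub>\<le>\<^sub>0"
      by (auto simp: subset_iff)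
    then show False
      using symmetric_sector_Int_nonpos_Reals[OF assms] \<open>0 < e\<close> by fastforce
  qed
  then show ?thesis
    using symmetric_sector_Int_nonpos_Reals[OF assms] interior_subset by blast
qed

lemma holomorphic_on_powr_interior_symmetric_sector:
  assumes "\<theta> < pi"
  shows "(\<lambda>z. z powr s) holomorphic_on interior (sector (- \<theta>) \<theta>)"
  using interior_symmetric_sector_Int_nonpos_Reals[OF assms] by (intro holomorphic_intros) auto

lemma continuous_on_powr_symmetric_sector:
  assumes "\<theta> < pi" "0 < Re s"
  shows "continuous_on (sector (- \<theta>) \<theta>) (\<lambda>z. z powr s)"
proof -
  have "sector (- \<theta>) \<theta> \<subseteq> {z. 0 \<le> Re z \<or> Im z \<noteq> 0}"
    using symmetric_sector_Int_nonpos_Reals[OF assms(1)] by (force simp: complex_nonpos_Reals_iff)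
  then show ?thesis
    using assms(2) by (intro continuous_intros) auto
qed

lemma Re_rcis_powr_of_real:
  assumes "0 \<le> r" "- pi < t" "t \<le> pi"
  shows "Re (rcis r t powr of_real \<beta>) = r powr \<beta> * cos (\<beta> * t)"
proof (cases "r = 0")
  case False
  with assms have "Ln (rcis r t) = of_real (ln r) + \<i> * t"
    by (simp add: Ln_Arg Arg_rcis)
  with assms False show ?thesis
    by (simp add: powr_def Re_exp)
qed simp

lemma Re_powr_symmetric_sector_ge:
  assumes \<theta>: "\<theta> < pi" and \<beta>: "0 \<le> \<beta>" "\<beta> * \<theta> \<le> pi" and z: "z \<in> sector (- \<theta>) \<theta>"
  shows "cos (\<beta> * \<theta>) * norm z powr \<beta> \<le> Re (z powr of_real \<beta>)"
proof -
  obtain r t where rt: "z = rcis r t" "0 \<le> r" "- \<theta> \<le> t" "t \<le> \<theta>"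
    using z by (auto simp: sector_def)
  then have "\<beta> * \<bar>t\<bar> \<le> \<beta> * \<theta>"
    using \<beta> by (intro mult_left_mono) auto
  then have "cos (\<beta> * \<theta>) \<le> cos \<bar>\<beta> * t\<bar>"
    using \<beta> by (intro cos_monotone_0_pi_le) (auto simp: abs_mult)
  with rt \<theta> show ?thesis
    by (simp add: Re_rcis_powr_of_real mult.commute mult_left_mono)
qed

lemma phragmen_lindelof_symmetric_sector:
  fixes g :: "complex \<Rightarrow> complex"
  assumes \<theta>: "0 < \<theta>" "\<theta> < pi" and order: "2 * \<theta> * \<rho> < pi"
    and g: "g holomorphic_on interior (sector (- \<theta>) \<theta>)" "continuous_on (sector (- \<theta>) \<theta>) g"
    and growth: "\<And>w. w \<in> sector (- \<theta>) \<theta> \<Longrightarrow> norm (g w) \<le> C * exp (c * norm w powr \<rho>)"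
    and rays: "\<And>r. 0 \<le> r \<Longrightarrow> norm (g (rcis r (- \<theta>))) \<le> K" "\<And>r. 0 \<le> r \<Longrightarrow> norm (g (rcis r \<theta>)) \<le> K"
    and z: "z \<in> sector (- \<theta>) \<theta>"
  shows "norm (g z) \<le> K"
proof -
  have "max \<rho> 0 < pi / (2 * \<theta>)"
    using \<theta> order by (simp add: field_simps)
  then obtain \<beta> where "max \<rho> 0 < \<beta>" "\<beta> < pi / (2 * \<theta>)"
    using dense by blast
  with \<theta> have \<beta>: "\<rho> < \<beta>" "0 < \<beta>" "\<beta> * \<theta> < pi / 2"
    by (simp_all add: field_simps)
  show ?thesis
  proof (rule phragmen_lindelof_order[where D = "\<lambda>w. w powr of_real \<beta>",
        OF _ g growth _ _ _ \<beta>(1,2) _ _ _ z])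
    show "closed (sector (- \<theta>) \<theta>)"
      using \<theta> by (intro closed_symmetric_sector) auto
    show "(\<lambda>w. w powr of_real \<beta>) holomorphic_on interior (sector (- \<theta>) \<theta>)"
      using \<theta>(2) by (rule holomorphic_on_powr_interior_symmetric_sector)
    show "continuous_on (sector (- \<theta>) \<theta>) (\<lambda>w. w powr of_real \<beta>)"
      using \<theta> \<beta> by (intro continuous_on_powr_symmetric_sector) auto
    show "cos (\<beta> * \<theta>) * norm w powr \<beta> \<le> Re (w powr of_real \<beta>)" if "w \<in> sector (- \<theta>) \<theta>" for w
      using \<theta> \<beta> that by (intro Re_powr_symmetric_sector_ge) auto
    show "0 < cos (\<beta> * \<theta>)"
      using \<theta> \<beta> by (intro cos_gt_zero_pi) (auto intro: less_trans[of _ 0])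
    show "norm (g w) \<le> K" if "w \<in> frontier (sector (- \<theta>) \<theta>)" for w
      using that \<theta> rays by (elim frontier_symmetric_sector[rotated 2]) auto
    show "0 \<le> K"
      using order_trans[OF norm_ge_zero rays(1)[OF order_refl]] by simp
  qed
qed

theorem phragmen_lindelof_sector:
  fixes g :: "complex \<Rightarrow> complex"
  assumes ab: "a < b" "b - a < 2 * pi" and order: "(b - a) * \<rho> < pi"
    and g: "g holomorphic_on interior (sector a b)" "continuous_on (sector a b) g"
    and growth: "\<And>w. w \<in> sector a b \<Longrightarrow> norm (g w) \<le> C * exp (c * norm w powr \<rho>)"
    and rays: "\<And>r. 0 \<le> r \<Longrightarrow> norm (g (rcis r a)) \<le> K" "\<And>r. 0 \<le> r \<Longrightarrow> norm (g (rcis r b)) \<le> K"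
    and z: "z \<in> sector a b"
  shows "norm (g z) \<le> K"
proof -
  define \<theta> \<phi> where "\<theta> = (b - a) / 2" and "\<phi> = (a + b) / 2"
  let ?S = "sector (- \<theta>) \<theta>" and ?rot = "\<lambda>w. cis \<phi> * w"
  have a: "a = - \<theta> + \<phi>" and b: "b = \<theta> + \<phi>"
    by (simp_all add: \<theta>_def \<phi>_def field_simps)
  have rot: "?rot ` ?S = sector a b"
    by (simp add: rotate_sector a b)
  have "?rot ` interior ?S = interior (sector a b)"
    unfolding rot[symmetric]
    by (intro interior_injective_linear_image[symmetric] bounded_linear.linear bounded_linear_mult_right)
       (auto simp: inj_on_def)
  have "norm (g (?rot w)) \<le> K" if "w \<in> ?S" for w
  proof (rule phragmen_lindelof_symmetric_sector[where g = "\<lambda>w. g (?rot w)", OF _ _ _ _ _ _ _ _ that])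
    show "(\<lambda>w. g (?rot w)) holomorphic_on interior ?S"
      using g(1) \<open>?rot ` interior ?S = interior (sector a b)\<close>
      by (intro holomorphic_on_compose_gen[of ?rot _ g, unfolded o_def] holomorphic_intros) auto
    show "continuous_on ?S (\<lambda>w. g (?rot w))"
      using rot by (intro continuous_on_compose2[OF g(2)] continuous_intros) auto
    show "norm (g (?rot w)) \<le> C * exp (c * norm w powr \<rho>)" if "w \<in> ?S" for w
      using growth[of "?rot w"] that rot by (auto simp: norm_mult)
    show "norm (g (?rot (rcis r (- \<theta>)))) \<le> K" "norm (g (?rot (rcis r \<theta>))) \<le> K" if "0 \<le> r" for r
      using rays[OF that] by (simp_all add: a b cis_rcis_eq rcis_mult add.commute)
    show "0 < \<theta>" "\<theta> < pi" "2 * \<theta> * \<rho> < pi"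
      using ab order by (auto simp: \<theta>_def left_diff_distrib)
  qed
  then show ?thesis
    using z unfolding rot[symmetric] by auto
qed

lemma phragmen_lindelof_adjacent_sectors:
  fixes g :: "complex \<Rightarrow> complex"
  assumes abm: "a < m" "m < b" "m - a < 2 * pi" "b - m < 2 * pi"
    and order: "(m - a) * \<rho> < pi" "(b - m) * \<rho> < pi"
    and g: "g holomorphic_on interior (sector a b)" "continuous_on (sector a b) g"
    and growth: "\<And>w. w \<in> sector a b \<Longrightarrow> norm (g w) \<le> C * exp (c * norm w powr \<rho>)"
    and rays: "\<And>r t. 0 \<le> r \<Longrightarrow> t \<in> {a, m, b} \<Longrightarrow> norm (g (rcis r t)) \<le> K"
    and z: "z \<in> sector a b"
  shows "norm (g z) \<le> K"
proof -
  have subsector_bound: "norm (g z) \<le> K"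
    if z: "z \<in> sector a' b'" and "a \<le> a'" "a' < b'" "b' \<le> b" "b' - a' < 2 * pi" "(b' - a') * \<rho> < pi"
      and "a' \<in> {a, m, b}" "b' \<in> {a, m, b}" for a' b'
  proof -
    have sub: "sector a' b' \<subseteq> sector a b"
      using that by (intro sector_mono)
    show ?thesis
    proof (rule phragmen_lindelof_sector[OF _ _ _ _ _ _ _ _ z])
      show "g holomorphic_on interior (sector a' b')"
        using g(1) interior_mono[OF sub] by (rule holomorphic_on_subset)
      show "continuous_on (sector a' b') g"
        using g(2) sub by (rule continuous_on_subset)
      show "norm (g w) \<le> C * exp (c * norm w powr \<rho>)" if "w \<in> sector a' b'" for w
        using that sub by (intro growth) auto
    qed (use that in \<open>auto intro: rays\<close>)
  qed
  have "z \<in> sector a m \<or> z \<in> sector m b"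
    using z sector_split[of a m b] abm by simp
  then show ?thesis
    using subsector_bound[of a m] subsector_bound[of m b] abm order by auto
qed

corollary phragmen_lindelof_sector_intermediate_ray:
  fixes g :: "complex \<Rightarrow> complex"
  assumes abm: "a < m" "m < b" "b - a < 2 * pi" and order: "(m - a) * \<rho> < pi" "(b - m) * \<rho> < pi"
    and g: "g holomorphic_on interior (sector a b)" "continuous_on (sector a b) g"
    and growth: "\<And>w. w \<in> sector a b \<Longrightarrow> norm (g w) \<le> C * exp (c * norm w powr \<rho>)"
    and rays: "\<And>r. 0 \<le> r \<Longrightarrow> norm (g (rcis r a)) \<le> K" "\<And>r. 0 \<le> r \<Longrightarrow> norm (g (rcis r b)) \<le> K"
    and intermediate: "\<And>r. 0 \<le> r \<Longrightarrow> norm (g (rcis r m)) \<le> N"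
    and z: "z \<in> sector a b"
  shows "norm (g z) \<le> K"
proof -
  have bounded: "norm (g w) \<le> max K N" if "w \<in> sector a b" for w
  proof (rule phragmen_lindelof_adjacent_sectors[OF abm(1,2) _ _ order g growth _ that])
    show "norm (g (rcis r t)) \<le> max K N" if "0 \<le> r" "t \<in> {a, m, b}" for r t
      using rays intermediate that by (auto intro: max.coboundedI1 max.coboundedI2)
  qed (use abm in auto)
  \<comment> \<open>A bounded function has order 0, for which the condition on the order is void.\<close>
  show ?thesis
  proof (rule phragmen_lindelof_sector[OF _ abm(3) _ g _ rays z])
    show "norm (g w) \<le> max K N * exp (0 * norm w powr 0)" if "w \<in> sector a b" for w
      using bounded[OF that] by simp
  qed (use abm in auto)
qed

lemma upper_halfplane_eq_sector: "{z. 0 \<le> Im z} = sector 0 pi"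
proof (intro equalityI subsetI)
  fix z assume "z \<in> {z. 0 \<le> Im z}"
  then have "rcis (norm z) (Arg z) \<in> sector 0 pi"
    using Arg_bounded[of z] by (intro rcis_in_sector) (auto simp: Arg_less_0)
  then show "z \<in> sector 0 pi"
    by (simp add: rcis_cmod_Arg)
qed (auto simp: sector_def sin_ge_zero)

section \<open>Entire functions of exponential type\<close>

lemma exponential_type_upper_halfplane_bound:
  fixes F :: "complex \<Rightarrow> complex"
  assumes F: "F holomorphic_on {z. 0 < Im z}" "continuous_on {z. 0 \<le> Im z} F"
    and growth: "\<And>z. 0 \<le> Im z \<Longrightarrow> norm (F z) \<le> C * exp (\<sigma> * norm z)"
    and real: "\<And>x. norm (F (of_real x)) \<le> M"
    and z: "0 \<le> Im z"
  shows "norm (F z) \<le> M * exp (\<sigma> * Im z)"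
proof -
  define g where "g w = F w * exp (\<i> * of_real \<sigma> * w)" for w
  have norm_g: "norm (g w) = norm (F w) * exp (- \<sigma> * Im w)" for w
    by (simp add: g_def norm_mult)
  have g_real: "norm (g (of_real x)) \<le> M" for x
    using real by (simp add: norm_g)
  have "norm (g z) \<le> M"
  proof (rule phragmen_lindelof_sector_intermediate_ray[
        where g = g and a = 0 and m = "pi / 2" and b = pi and \<rho> = 1])
    have "interior (sector 0 pi) = {z. 0 < Im z}"
      using interior_halfspace_ge[of \<i> 0]
      by (simp add: inner_complex_def flip: upper_halfplane_eq_sector)
    then show "g holomorphic_on interior (sector 0 pi)"
      unfolding g_def by (auto intro!: holomorphic_intros F(1))
    show "continuous_on (sector 0 pi) g"
      unfolding g_def by (intro continuous_intros F(2)[unfolded upper_halfplane_eq_sector])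
    show "norm (g w) \<le> C * exp ((\<sigma> + \<bar>\<sigma>\<bar>) * norm w powr 1)" if "w \<in> sector 0 pi" for w
    proof -
      have F_bound: "norm (F w) \<le> C * exp (\<sigma> * norm w)"
        using growth[of w] that by (simp flip: upper_halfplane_eq_sector)
      have "norm (g w) \<le> norm (F w) * exp (\<bar>\<sigma>\<bar> * norm w)"
        using norm_exp[of "\<i> * of_real \<sigma> * w"] by (simp add: g_def norm_mult mult_left_mono)
      also have "\<dots> \<le> C * exp (\<sigma> * norm w) * exp (\<bar>\<sigma>\<bar> * norm w)"
        using F_bound by (rule mult_right_mono) simp
      finally show ?thesis
        by (simp add: distrib_right exp_add mult.assoc)
    qed
    show "norm (g (rcis r 0)) \<le> M" "norm (g (rcis r pi)) \<le> M" for r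
      using g_real[of r] g_real[of "- r"] by (simp_all add: rcis_def)
    show "norm (g (rcis r (pi / 2))) \<le> C" if "0 \<le> r" for r
      using growth[of "rcis r (pi / 2)"] that by (simp add: norm_g exp_minus field_simps)
  qed (use z in \<open>auto simp flip: upper_halfplane_eq_sector\<close>)
  then show ?thesis
    by (simp add: norm_g exp_minus field_simps)
qed

lemma exponential_type_plane_bound:
  fixes F :: "complex \<Rightarrow> complex"
  assumes F: "F holomorphic_on UNIV"
    and growth: "\<And>z. norm (F z) \<le> C * exp (\<sigma> * norm z)"
    and real: "\<And>x. norm (F (of_real x)) \<le> M"
  shows "norm (F z) \<le> M * exp (\<sigma> * \<bar>Im z\<bar>)"
proof -
  have upper: "norm (G z) \<le> M * exp (\<sigma> * Im z)"
    if "G holomorphic_on UNIV" "\<And>z. norm (G z) \<le> C * exp (\<sigma> * norm z)"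
      "\<And>x. norm (G (of_real x)) \<le> M" "0 \<le> Im z" for G z
    using that
    by (intro exponential_type_upper_halfplane_bound)
       (auto intro: holomorphic_on_subset holomorphic_on_imp_continuous_on)
  show ?thesis
  proof (cases "0 \<le> Im z")
    case True
    then show ?thesis using upper[OF F growth real] by simp
  next
    case False
    have "norm (F (- (- z))) \<le> M * exp (\<sigma> * Im (- z))"
    proof (rule upper)
      show "(\<lambda>z. F (- z)) holomorphic_on UNIV"
        by (intro holomorphic_on_compose_gen[OF _ F, unfolded o_def] holomorphic_intros) auto
      show "norm (F (- z)) \<le> C * exp (\<sigma> * norm z)" for z
        using growth[of "- z"] by simp
      show "norm (F (- of_real x)) \<le> M" for x
        using real[of "- x"] by simp
    qed (use False in simp)
    with False show ?thesis by simp
  qed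
qed

text \<open>Order at most 1 and type 0.\<close>
definition minimal_exponential_type :: "('a::real_normed_vector \<Rightarrow> 'b::real_normed_vector) \<Rightarrow> bool" where
  "minimal_exponential_type F \<longleftrightarrow> (\<forall>\<epsilon>>0. \<exists>C. \<forall>z. norm (F z) \<le> C * exp (\<epsilon> * norm z))"

lemma minimal_exponential_typeE:
  assumes "minimal_exponential_type F" "0 < \<epsilon>"
  obtains C where "0 \<le> C" "\<And>z. norm (F z) \<le> C * exp (\<epsilon> * norm z)"
proof -
  obtain C where C: "\<And>z. norm (F z) \<le> C * exp (\<epsilon> * norm z)"
    using assms unfolding minimal_exponential_type_def by blast
  moreover have "0 \<le> C"
    using order_trans[OF norm_ge_zero C[of 0]] by simp
  ultimately show ?thesis using that by blast
qed

lemma minimal_exponential_typeI_eventually: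
  fixes F :: "'a::{real_normed_vector, heine_borel} \<Rightarrow> 'b::real_normed_vector"
  assumes cont: "continuous_on UNIV F"
    and growth: "\<And>\<epsilon>. 0 < \<epsilon> \<Longrightarrow> \<forall>\<^sub>F z in at_infinity. norm (F z) \<le> exp (\<epsilon> * norm z)"
  shows "minimal_exponential_type F"
  unfolding minimal_exponential_type_def
proof (intro allI impI)
  fix \<epsilon> :: real assume "0 < \<epsilon>"
  then obtain R where R: "norm (F z) \<le> exp (\<epsilon> * norm z)" if "R \<le> norm z" for z
    using growth unfolding eventually_at_infinity by blast
  have "compact (F ` cball 0 R)"
    using cont by (intro compact_continuous_image compact_cball) (auto intro: continuous_on_subset)
  then obtain K where "\<forall>u\<in>F ` cball 0 R. norm u \<le> K"
    using compact_imp_bounded bounded_iff by metis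
  then have K: "norm (F z) \<le> K" if "norm z \<le> R" for z
    using that by simp
  have "norm (F z) \<le> max K 1 * exp (\<epsilon> * norm z)" for z
  proof (cases "norm z \<le> R")
    case True
    have "norm (F z) * 1 \<le> max K 1 * exp (\<epsilon> * norm z)"
      using K[OF True] \<open>0 < \<epsilon>\<close> by (intro mult_mono) auto
    then show ?thesis by simp
  next
    case False
    have "1 * norm (F z) \<le> max K 1 * exp (\<epsilon> * norm z)"
      using R[of z] False by (intro mult_mono) auto
    then show ?thesis by simp
  qed
  then show "\<exists>C. \<forall>z. norm (F z) \<le> C * exp (\<epsilon> * norm z)" by blast
qed

lemma minimal_exponential_type_bounded_linear:
  assumes "bounded_linear L" "minimal_exponential_type F"
  shows "minimal_exponential_type (\<lambda>z. L (F z))"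
  unfolding minimal_exponential_type_def
proof (intro allI impI)
  fix \<epsilon> :: real assume "0 < \<epsilon>"
  then obtain C where C: "\<And>z. norm (F z) \<le> C * exp (\<epsilon> * norm z)"
    using assms(2) minimal_exponential_typeE by metis
  obtain B where B: "0 < B" "\<And>x. norm (L x) \<le> norm x * B"
    using bounded_linear.pos_bounded[OF assms(1)] by blast
  have "norm (L (F z)) \<le> B * C * exp (\<epsilon> * norm z)" for z
  proof -
    have "norm (L (F z)) \<le> norm (F z) * B" by (rule B(2))
    also have "\<dots> \<le> C * exp (\<epsilon> * norm z) * B"
      using C B(1) by (intro mult_right_mono) auto
    finally show ?thesis by (simp add: mult_ac)
  qed
  then show "\<exists>C. \<forall>z. norm (L (F z)) \<le> C * exp (\<epsilon> * norm z)" by blast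
qed

lemma minimal_exponential_type_compose_affine:
  assumes "bounded_linear A" "minimal_exponential_type F"
  shows "minimal_exponential_type (\<lambda>z. F (a + A z))"
  unfolding minimal_exponential_type_def
proof (intro allI impI)
  fix \<epsilon> :: real assume "0 < \<epsilon>"
  obtain B where B: "0 < B" "\<And>z. norm (A z) \<le> norm z * B"
    using bounded_linear.pos_bounded[OF assms(1)] by blast
  obtain C where C: "0 \<le> C" "\<And>z. norm (F z) \<le> C * exp (\<epsilon> / B * norm z)"
    using assms(2) \<open>0 < \<epsilon>\<close> B(1) minimal_exponential_typeE[of F "\<epsilon> / B"] by auto
  have "norm (F (a + A z)) \<le> C * exp (\<epsilon> / B * norm a) * exp (\<epsilon> * norm z)" for z
  proof -
    have "\<epsilon> / B * norm (a + A z) \<le> \<epsilon> / B * (norm a + norm z * B)"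
      using norm_triangle_ineq[of a "A z"] B(2)[of z] \<open>0 < \<epsilon>\<close> B(1) by (intro mult_left_mono) auto
    also have "\<dots> = \<epsilon> / B * norm a + \<epsilon> * norm z"
      using B(1) by (simp add: field_simps)
    finally have "C * exp (\<epsilon> / B * norm (a + A z)) \<le> C * exp (\<epsilon> / B * norm a + \<epsilon> * norm z)"
      using C(1) by (simp add: mult_left_mono)
    then show ?thesis
      using C(2)[of "a + A z"] by (simp add: exp_add mult.assoc)
  qed
  then show "\<exists>C. \<forall>z. norm (F (a + A z)) \<le> C * exp (\<epsilon> * norm z)" by blast
qed

lemma minimal_exponential_type_bounded_on_real_axis_imp_bounded:
  fixes F :: "complex \<Rightarrow> complex"
  assumes F: "F holomorphic_on UNIV" "minimal_exponential_type F"
    and real: "\<And>x. norm (F (of_real x)) \<le> M"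
  shows "norm (F z) \<le> M"
proof -
  have "norm (F z) \<le> M * exp (\<epsilon> * \<bar>Im z\<bar>)" if "0 < \<epsilon>" for \<epsilon>
    using F(2) that by (rule minimal_exponential_typeE) (rule exponential_type_plane_bound[OF F(1) _ real])
  then show ?thesis
    by (rule le_mult_exp_imp_le)
qed

theorem minimal_exponential_type_bounded_on_line_imp_constant:
  fixes F :: "complex \<Rightarrow> complex"
  assumes F: "F holomorphic_on UNIV" "minimal_exponential_type F"
    and v: "v \<noteq> 0" and line: "\<And>t. norm (F (a + of_real t * v)) \<le> M"
  shows "F constant_on UNIV"
proof (rule Liouville_theorem[OF F(1)])
  let ?G = "\<lambda>z. F (a + z * v)"
  have "?G holomorphic_on UNIV"
    by (intro holomorphic_on_compose_gen[OF _ F(1), unfolded o_def] holomorphic_intros) auto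
  moreover have "minimal_exponential_type ?G"
    by (intro minimal_exponential_type_compose_affine bounded_linear_mult_left F(2))
  ultimately have G_bounded: "norm (?G z) \<le> M" for z
    using line by (rule minimal_exponential_type_bounded_on_real_axis_imp_bounded)
  have "norm (F z) \<le> M" for z
    using G_bounded[of "(z - a) / v"] v by simp
  then show "bounded (range F)"
    by (auto simp: bounded_iff)
qed

section \<open>Holomorphy with respect to a complex structure\<close>

locale complex_structure =
  fixes J :: "'a::real_inner \<Rightarrow> 'a"
  assumes bounded_linear_J: "bounded_linear J"
    and J_J: "J (J x) = - x"
begin

definition entire :: "(complex \<Rightarrow> 'a) \<Rightarrow> bool" where
  "entire F \<longleftrightarrow> (\<forall>z. \<exists>D. (F has_derivative D) (at z) \<and> D \<i> = J (D 1))"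

text \<open>The functional that is complex-linear for \<open>J\<close> and has real part the inner product with \<open>w\<close>.\<close>
definition component :: "'a \<Rightarrow> 'a \<Rightarrow> complex" where
  "component w x = Complex (x \<bullet> w) (- (J x \<bullet> w))"

lemma bounded_linear_component: "bounded_linear (component w)"
proof -
  have "bounded_linear (\<lambda>x. (x \<bullet> w) *\<^sub>R 1 + (J x \<bullet> w) *\<^sub>R (- \<i>))"
    by (intro bounded_linear_add bounded_linear_compose[OF bounded_linear_scaleR_left]
          bounded_linear_inner_left_comp bounded_linear_J bounded_linear_ident)
  also have "(\<lambda>x. (x \<bullet> w) *\<^sub>R 1 + (J x \<bullet> w) *\<^sub>R (- \<i>)) = component w"
    by (simp add: component_def complex_eq_iff fun_eq_iff)
  finally show ?thesis .
qed

lemma component_J: "component w (J x) = \<i> * component w x"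
  by (simp add: component_def J_J complex_eq_iff)

lemma entire_imp_holomorphic_component:
  assumes "entire F"
  shows "(\<lambda>z. component w (F z)) holomorphic_on UNIV"
proof (intro holomorphic_onI)
  fix z
  interpret component: bounded_linear "component w" by (rule bounded_linear_component)
  obtain D where D: "(F has_derivative D) (at z)" and CR: "D \<i> = J (D 1)"
    using assms unfolding entire_def by blast
  interpret D: bounded_linear D using D by (rule has_derivative_bounded_linear)
  have "(\<lambda>h. component w (D h)) = (*) (component w (D 1))"
  proof
    fix h
    have "D h = D (Re h *\<^sub>R 1 + Im h *\<^sub>R \<i>)"
      by (rule arg_cong[of _ _ D]) (simp add: complex_eq_iff)
    also have "\<dots> = Re h *\<^sub>R D 1 + Im h *\<^sub>R J (D 1)"
      by (simp only: D.add D.scaleR CR)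
    finally have "component w (D h) = (Re h + Im h * \<i>) * component w (D 1)"
      by (simp add: component.add component.scaleR component_J scaleR_conv_of_real algebra_simps)
    also have "Re h + Im h * \<i> = h"
      by (simp add: complex_eq_iff)
    finally show "component w (D h) = component w (D 1) * h"
      by (simp add: mult.commute)
  qed
  moreover have "((\<lambda>z. component w (F z)) has_derivative (\<lambda>h. component w (D h))) (at z)"
    using D by (rule component.has_derivative)
  ultimately have "((\<lambda>z. component w (F z)) has_field_derivative component w (D 1)) (at z)"
    by (simp only: has_field_derivative_def)
  then show "(\<lambda>z. component w (F z)) field_differentiable at z within UNIV"
    by (auto simp: field_differentiable_def)
qed

lemma constant_components_imp_constant:
  assumes "\<And>w. (\<lambda>z. component w (F z)) constant_on UNIV"
  shows "F z = F z'"
proof -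
  define w where "w = F z - F z'"
  have "component w (F z) = component w (F z')"
    using assms[of w] by (auto simp: constant_on_def)
  then have "F z \<bullet> w = F z' \<bullet> w"
    by (simp add: component_def)
  then have "w \<bullet> w = 0"
    by (simp add: w_def inner_diff_left)
  then show ?thesis
    by (simp add: w_def)
qed

theorem entire_minimal_exponential_type_bounded_on_line_imp_constant:
  assumes F: "entire F" "minimal_exponential_type F"
    and v: "v \<noteq> 0" and line: "\<And>t. norm (F (a + of_real t * v)) \<le> M"
  shows "F z = F z'"
proof (rule constant_components_imp_constant[where F = F])
  fix w
  obtain B where B: "0 < B" "\<And>x. norm (component w x) \<le> norm x * B"
    using bounded_linear.pos_bounded[OF bounded_linear_component] by blast
  have "norm (component w (F (a + of_real t * v))) \<le> M * B" for t
    using B mult_right_mono[OF line, of B t] by (meson less_imp_le order_trans)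
  with entire_imp_holomorphic_component[OF F(1)]
    minimal_exponential_type_bounded_linear[OF bounded_linear_component F(2)] v
  show "(\<lambda>z. component w (F z)) constant_on UNIV"
    by (rule minimal_exponential_type_bounded_on_line_imp_constant)
qed

end

section \<open>Slice regular functions\<close>

definition slice_embed :: "quat \<Rightarrow> complex \<Rightarrow> quat" where
  "slice_embed I z = slice_pt I (Re z) (Im z)"

lemma norm_slice_embed:
  assumes "I \<in> imag_units"
  shows "norm (slice_embed I z) = norm z"
proof -
  obtain a b c where I: "I = (0, a, b, c)" and unit: "a\<^sup>2 + b\<^sup>2 + c\<^sup>2 = 1"
    using assms by (auto simp: imag_units_def)
  have "(Im z * a)\<^sup>2 + ((Im z * b)\<^sup>2 + (Im z * c)\<^sup>2) = (Im z)\<^sup>2 * (a\<^sup>2 + b\<^sup>2 + c\<^sup>2)"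
    by (simp add: algebra_simps)
  with unit show ?thesis
    by (simp add: slice_embed_def slice_pt_def qreal_def I norm_prod_def cmod_def)
qed

lemma slice_embed_of_real [simp]: "slice_embed I (of_real x) = qreal x"
  by (simp add: slice_embed_def slice_pt_def)

lemma slice_embed_0 [simp]: "slice_embed I 0 = qreal 0"
  using slice_embed_of_real[of I 0] by simp

lemma quat_in_slice:
  obtains I z where "I \<in> imag_units" "q = slice_embed I z"
proof -
  obtain a b where q: "q = (a, b)" by (cases q)
  have unit: "(0, u) \<in> imag_units" if "norm u = 1" for u :: "real \<times> real \<times> real"
    using that by (cases u) (auto simp: imag_units_def norm_prod_def add.assoc)
  obtain u where u: "norm u = 1" "b = norm b *\<^sub>R u"
  proof (cases "b = 0")
    case True
    obtain u :: "real \<times> real \<times> real" where "norm u = 1"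
      by (rule vector_choose_size[OF zero_le_one])
    with True show ?thesis using that by simp
  next
    case False
    then show ?thesis using that[of "sgn b"] by (simp add: norm_sgn sgn_div_norm)
  qed
  show ?thesis
    using that[OF unit[OF u(1)], of "Complex a (norm b)"]
    by (simp add: q slice_embed_def slice_pt_def qreal_def flip: u(2) zero_prod_def)
qed

lemma complex_structure_qmult:
  assumes "I \<in> imag_units"
  shows "complex_structure (qmult I)"
proof (rule complex_structure.intro)
  obtain x y z where I: "I = (0, x, y, z)" and "x\<^sup>2 + y\<^sup>2 + z\<^sup>2 = 1"
    using assms by (auto simp: imag_units_def)
  then have "x * x = 1 - y * y - z * z"
    by (simp add: power2_eq_square)
  then have unit: "t * (x * x) = t - t * (y * y) - t * (z * z)" for t
    by (simp add: right_diff_distrib)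
  show "qmult I (qmult I q) = - q" for q
    by (cases q) (simp add: I unit algebra_simps)
  have "linear (qmult I)"
    by (rule linearI) (auto simp: I algebra_simps)
  then show "bounded_linear (qmult I)"
    by (simp add: linear_conv_bounded_linear)
qed

lemma slice_regular_imp_entire:
  assumes "slice_regular f" "I \<in> imag_units"
  shows "complex_structure.entire (qmult I) (\<lambda>z. f (slice_embed I z))"
proof -
  interpret complex_structure "qmult I"
    using assms(2) by (rule complex_structure_qmult)
  interpret qmult: bounded_linear "qmult I"
    by (rule bounded_linear_J)
  show ?thesis
    unfolding entire_def
  proof
    fix z
    obtain D where D: "((\<lambda>p. f (slice_pt I (fst p) (snd p))) has_derivative D) (at (Re z, Im z))"
      and CR: "(1/2) *\<^sub>R (D (1, 0) + qmult I (D (0, 1))) = 0"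
      using assms unfolding slice_regular_def by blast
    have "((\<lambda>z. (Re z, Im z)) has_derivative (\<lambda>h. (Re h, Im h))) (at z)"
      by (intro derivative_intros bounded_linear_imp_has_derivative bounded_linear_Re bounded_linear_Im)
    from has_derivative_compose[OF this D]
    have "((\<lambda>z. f (slice_embed I z)) has_derivative (\<lambda>h. D (Re h, Im h))) (at z)"
      by (simp add: slice_embed_def)
    moreover have "D (0, 1) = qmult I (D (1, 0))"
    proof -
      have "D (1, 0) = - qmult I (D (0, 1))"
        using CR by (simp add: eq_neg_iff_add_eq_0)
      then show ?thesis
        by (simp add: J_J linear_neg[OF qmult.linear])
    qed
    ultimately show "\<exists>D. ((\<lambda>z. f (slice_embed I z)) has_derivative D) (at z) \<and> D \<i> = qmult I (D 1)"
      by (intro exI[of _ "\<lambda>h. D (Re h, Im h)"]) simp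
  qed
qed

lemma slice_regular_bounded_on_line_imp_constant_on_slice:
  assumes reg: "slice_regular f" and I: "I \<in> imag_units"
    and growth: "\<forall>\<epsilon>>0. \<exists>R. \<forall>q. norm q \<ge> R \<longrightarrow> norm (f q) < exp (\<epsilon> * norm q)"
    and v: "v \<noteq> 0" and line: "\<And>t. norm (f (slice_embed I (a + of_real t * v))) \<le> M"
  shows "f (slice_embed I z) = f (slice_embed I z')"
proof -
  interpret complex_structure "qmult I"
    using I by (rule complex_structure_qmult)
  have entire: "entire (\<lambda>z. f (slice_embed I z))"
    using reg I by (rule slice_regular_imp_entire)
  have "minimal_exponential_type (\<lambda>z. f (slice_embed I z))"
  proof (rule minimal_exponential_typeI_eventually)
    show "continuous_on UNIV (\<lambda>z. f (slice_embed I z))"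
      using entire unfolding entire_def
      by (meson continuous_at_imp_continuous_on has_derivative_continuous)
    show "\<forall>\<^sub>F z in at_infinity. norm (f (slice_embed I z)) \<le> exp (\<epsilon> * norm z)" if \<epsilon>: "0 < \<epsilon>" for \<epsilon>
    proof -
      obtain R where "\<And>q. R \<le> norm q \<Longrightarrow> norm (f q) < exp (\<epsilon> * norm q)"
        using growth \<epsilon> by blast
      then show ?thesis
        unfolding eventually_at_infinity by (metis I norm_slice_embed less_imp_le)
    qed
  qed
  from entire_minimal_exponential_type_bounded_on_line_imp_constant[OF entire this v line]
  show ?thesis .
qed

theorem theorem4p9:
  fixes f :: "quat \<Rightarrow> quat"
  assumes reg: "slice_regular f"
    and growth: "\<forall>\<epsilon>>0. \<exists>R. \<forall>q. norm q \<ge> R \<longrightarrow> norm (f q) < exp (\<epsilon> * norm q)"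
    and line: "\<exists>I\<in>imag_units. \<exists>a1 a2 v1 v2 M. (v1, v2) \<noteq> (0, 0) \<and>
                 (\<forall>t::real. norm (f (slice_pt I (a1 + t * v1) (a2 + t * v2))) \<le> M)"
  shows "\<exists>c. \<forall>q. f q = c"
proof -
  note constant_on_slice = slice_regular_bounded_on_line_imp_constant_on_slice[OF reg _ growth]
  obtain I a1 a2 v1 v2 M where I: "I \<in> imag_units" and v: "(v1, v2) \<noteq> (0, 0)"
    and M: "\<And>t. norm (f (slice_pt I (a1 + t * v1) (a2 + t * v2))) \<le> M"
    using line by blast
  have "Complex v1 v2 \<noteq> 0"
    using v by (simp add: complex_eq_iff)
  moreover have "norm (f (slice_embed I (Complex a1 a2 + of_real t * Complex v1 v2))) \<le> M" for t
    using M by (simp add: slice_embed_def)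
  ultimately have real: "f (qreal x) = f (qreal 0)" for x
    using constant_on_slice[OF I, of "Complex v1 v2" "Complex a1 a2" M "of_real x" 0] by simp
  have "f q = f (qreal 0)" for q
  proof -
    obtain J z where J: "J \<in> imag_units" and q: "q = slice_embed J z"
      by (rule quat_in_slice)
    have "norm (f (slice_embed J (0 + of_real t * 1))) \<le> norm (f (qreal 0))" for t
      by (simp add: real[of t])
    from constant_on_slice[OF J one_neq_zero this, of z 0] show ?thesis
      by (simp add: q)
  qed
  then show ?thesis by blast
qed

end
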